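(* Let $N=N(n)$ be a sequence of positive integers with $N/n\to c\in(0,\infty)$ as $n\to\infty$, and let $(\sigma_{ij}(n);\,1\le i\le N,\,1\le j\le n,\,n\ge1)$ be an array of real numbers such that: (i) there is a finite $\sigma_{\max}>0$ with $\sup_{n\ge 1}\max_{1\le i\le N,\,1\le j\le n}|\sigma_{ij}(n)|\le\sigma_{\max}$; (ii) there is a real number $\sigma_{\min}^2>0$ with $\liminf_{n}\min_{1\le j\le n}\frac1n\sum_{i=1}^N\sigma_{ij}^2(n)\ge\sigma_{\min}^2$. Let $\rho>0$, and let $T(-\rho)=\mathrm{diag}(t_i(-\rho);1\le i\le N)$ and $D_j=\mathrm{diag}(\sigma_{ij}^2(n);1\le i\le N)$ be as defined in the context. 1. Let $A_n=(a_{\ell,m})_{1\le\ell,m\le n}$ be the matrix defined by $$a_{\ell,m}=\frac1n\,\frac{\frac1n\mathrm{Tr}\, D_\ell D_mT(-\rho)^2}{\left(1+\frac1n\mathrm{Tr}\, D_\ell T(-\rho)\right)^2},\qquad 1\le\ell,m\le n.$$ Then the quantity $\mathcal V_n=-\log\det(I_n-A_n)$ is well-defined. 2. Let $\mathcal W_n=\mathrm{Tr}\,A_n$ and let $\kappa$ be a real number satisfying $\kappa\ge-1$. Then, as $n\to\infty$ and $N/n\to c$, $$0<\liminf_n\left(\mathcal V_n+\kappa\mathcal W_n\right)\le\limsup_n\left(\mathcal V_n+\kappa\mathcal W_n\right)<\infty .$$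
   Context: $\mathcal S(\mathbb R^+)$ denotes the set of Stieltjes transforms $f(z)=\int\frac{\nu(d\lambda)}{\lambda-z}$, $z\in\mathbb C\setminus\mathbb R^+$, of probability measures $\nu$ supported in $\mathbb R^+=[0,\infty)$. For each $n$, $(t_1(z),\dots,t_N(z))$ denotes the unique solution in $\mathcal S(\mathbb R^+)^N$ (its existence and uniqueness are known) of the system $$t_i(z)=\frac{1}{-z+\frac1n\sum_{j=1}^n\frac{\sigma_{ij}^2(n)}{1+\frac1n\sum_{\ell=1}^N\sigma_{\ell j}^2(n)t_\ell(z)}},\qquad 1\le i\le N.$$ $T(z)=\mathrm{diag}(t_i(z);1\le i\le N)$ and $D_j=\mathrm{diag}(\sigma_{ij}^2(n);1\le i\le N)$ for $1\le j\le n$ (the dependence on $n$ is dropped). $I_n$ is the $n\times n$ identity matrix. *)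

theory Defs
  imports "HOL-Probability.Probability" "Jordan_Normal_Form.Determinant"
begin

text \<open>
  Matrices, and the row and column indices of the variance profile, are numbered from 0 as in
  \<^theory>\<open>Jordan_Normal_Form.Matrix\<close>: the index ranges \<open>1 \<le> i \<le> N\<close> and \<open>1 \<le> j \<le> n\<close> become
  \<open>i < N\<close> and \<open>j < n\<close>. The argument \<open>s\<close> below is the array \<open>\<sigma>(n)\<close> for one fixed \<open>n\<close>.
\<close>

text \<open>Only the values off the nonnegative real axis are constrained; HOL functions being total,
  a member may take arbitrary values on that axis.\<close>

definition stieltjes_transforms :: "(complex \<Rightarrow> complex) set" where
  "stieltjes_transforms =
     {f. \<exists>\<nu> :: real measure. prob_space \<nu> \<and> sets \<nu> = sets borel \<and> (AE x in \<nu>. 0 \<le> x) \<and>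
           (\<forall>z. z \<notin> \<real>\<^sub>\<ge>\<^sub>0 \<longrightarrow> f z = (LINT x|\<nu>. 1 / (complex_of_real x - z)))}"

definition solves_system ::
    "(nat \<Rightarrow> nat \<Rightarrow> real) \<Rightarrow> nat \<Rightarrow> nat \<Rightarrow> (nat \<Rightarrow> complex \<Rightarrow> complex) \<Rightarrow> bool" where
  "solves_system s N n t \<longleftrightarrow>
     (\<forall>i<N. t i \<in> stieltjes_transforms) \<and>
     (\<forall>i<N. \<forall>z. z \<notin> \<real>\<^sub>\<ge>\<^sub>0 \<longrightarrow>
        t i z = 1 / (- z + 1 / of_nat n * (\<Sum>j<n. complex_of_real ((s i j)\<^sup>2) /
                  (1 + 1 / of_nat n * (\<Sum>l<N. complex_of_real ((s l j)\<^sup>2) * t l z)))))"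

definition mat_trace :: "'a :: comm_monoid_add mat \<Rightarrow> 'a" where
  "mat_trace M = (\<Sum>i<dim_row M. M $$ (i, i))"

definition T_mat :: "nat \<Rightarrow> (nat \<Rightarrow> complex \<Rightarrow> complex) \<Rightarrow> complex \<Rightarrow> complex mat" where
  "T_mat N t z = mat_diag N (\<lambda>i. t i z)"

definition D_mat :: "(nat \<Rightarrow> nat \<Rightarrow> real) \<Rightarrow> nat \<Rightarrow> nat \<Rightarrow> real mat" where
  "D_mat s N j = mat_diag N (\<lambda>i. (s i j)\<^sup>2)"

text \<open>On the negative real axis the matrix \<open>T\<close> is real (see \<open>T_mat_neg_real\<close> below), so that its
  entrywise real part is \<open>T(-\<rho>)\<close> itself, as a real matrix.\<close>

definition T_neg :: "nat \<Rightarrow> (nat \<Rightarrow> complex \<Rightarrow> complex) \<Rightarrow> real \<Rightarrow> real mat" where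
  "T_neg N t \<rho> = map_mat Re (T_mat N t (complex_of_real (- \<rho>)))"

definition A_mat ::
    "(nat \<Rightarrow> nat \<Rightarrow> real) \<Rightarrow> nat \<Rightarrow> nat \<Rightarrow> (nat \<Rightarrow> complex \<Rightarrow> complex) \<Rightarrow> real \<Rightarrow> real mat" where
  "A_mat s N n t \<rho> = Matrix.mat n n (\<lambda>(l, m).
     1 / real n *
       ((1 / real n * mat_trace (D_mat s N l * D_mat s N m * T_neg N t \<rho> ^\<^sub>m 2)) /
        (1 + 1 / real n * mat_trace (D_mat s N l * T_neg N t \<rho>))\<^sup>2))"

definition V_seq ::
    "(nat \<Rightarrow> nat \<Rightarrow> real) \<Rightarrow> nat \<Rightarrow> nat \<Rightarrow> (nat \<Rightarrow> complex \<Rightarrow> complex) \<Rightarrow> real \<Rightarrow> real" where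
  "V_seq s N n t \<rho> = - ln (Determinant.det (1\<^sub>m n - A_mat s N n t \<rho>))"

definition W_seq ::
    "(nat \<Rightarrow> nat \<Rightarrow> real) \<Rightarrow> nat \<Rightarrow> nat \<Rightarrow> (nat \<Rightarrow> complex \<Rightarrow> complex) \<Rightarrow> real \<Rightarrow> real" where
  "W_seq s N n t \<rho> = mat_trace (A_mat s N n t \<rho>)"

lemma stieltjes_transform_neg:
  assumes "f \<in> stieltjes_transforms" and "0 < \<rho>"
  shows "f (complex_of_real (- \<rho>)) = complex_of_real (Re (f (complex_of_real (- \<rho>))))"
    and "0 \<le> Re (f (complex_of_real (- \<rho>)))"
proof -
  from assms(1) obtain \<nu> :: "real measure" where \<nu>: "AE x in \<nu>. 0 \<le> x"
    and f: "\<And>z. z \<notin> \<real>\<^sub>\<ge>\<^sub>0 \<Longrightarrow> f z = (LINT x|\<nu>. 1 / (complex_of_real x - z))"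
    unfolding stieltjes_transforms_def by blast
  have "complex_of_real (- \<rho>) \<notin> \<real>\<^sub>\<ge>\<^sub>0"
    using assms(2) by (simp add: complex_nonneg_Reals_iff)
  then have "f (complex_of_real (- \<rho>)) = (LINT x|\<nu>. complex_of_real (1 / (x + \<rho>)))"
    by (simp add: f)
  also have "\<dots> = complex_of_real (LINT x|\<nu>. 1 / (x + \<rho>))"
    by (rule integral_complex_of_real)
  finally have eq: "f (complex_of_real (- \<rho>)) = complex_of_real (LINT x|\<nu>. 1 / (x + \<rho>))" .
  then show "f (complex_of_real (- \<rho>)) = complex_of_real (Re (f (complex_of_real (- \<rho>))))"
    by simp
  have "0 \<le> (LINT x|\<nu>. 1 / (x + \<rho>))"
    using \<nu> assms(2) by (intro integral_nonneg_AE) (auto elim!: eventually_mono)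
  then show "0 \<le> Re (f (complex_of_real (- \<rho>)))"
    unfolding eq by simp
qed

lemma T_mat_neg_real:
  assumes "\<forall>i<N. t i \<in> stieltjes_transforms" and "0 < \<rho>"
  shows "map_mat complex_of_real (T_neg N t \<rho>) = T_mat N t (complex_of_real (- \<rho>))"
  using stieltjes_transform_neg(1)[OF _ assms(2)] assms(1)
  by (intro eq_matI) (auto simp: T_neg_def T_mat_def mat_diag_def)

text \<open>The denominators in the entries of \<open>A\<close> do not vanish, so the convention \<open>x / 0 = 0\<close> plays
  no role there.\<close>

lemma A_mat_denominator_pos:
  assumes "\<forall>i<N. t i \<in> stieltjes_transforms" and "0 < \<rho>"
  shows "0 < 1 + 1 / real n * mat_trace (D_mat s N l * T_neg N t \<rho>)"
proof -
  have "mat_trace (D_mat s N l * T_neg N t \<rho>) =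
          (\<Sum>i<N. (s i l)\<^sup>2 * Re (t i (complex_of_real (- \<rho>))))"
    unfolding mat_trace_def D_mat_def
    by (subst mat_diag_mult_left[where n = N and nr = N])
      (auto simp: T_neg_def T_mat_def mat_diag_def intro!: sum.cong)
  also have "\<dots> \<ge> 0"
    using stieltjes_transform_neg(2)[OF _ assms(2)] assms(1)
    by (intro sum_nonneg mult_nonneg_nonneg) auto
  finally show ?thesis
    by (simp add: add_pos_nonneg)
qed

end

theory Submission
  imports Defs "Jordan_Normal_Form.Schur_Decomposition"
begin

text \<open>
  Write \<open>\<delta>\<^sub>j = (1/n) Tr D\<^sub>j T\<close> and \<open>u\<^sub>j = 1 + \<delta>\<^sub>j\<close>. The fixed-point equation gives
  \<open>u\<^sup>T A \<le> u\<^sup>T - 1\<close>, and \<open>u\<close> is bounded by a constant \<open>U\<close>, so conjugating the nonnegative matrix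
  \<open>A\<close> by \<open>diag u\<close> makes all column sums at most \<open>1 - 1/U\<close>. Moreover \<open>A\<close> is a positive diagonal
  matrix times a Gram matrix, so its eigenvalues are real and lie in \<open>[0, 1 - 1/U]\<close>. Summing
  \<open>x + x\<^sup>2/2 \<le> -ln (1 - x) \<le> U x\<close> over the eigenvalues gives
  \<open>Tr A\<^sup>2 / 2 \<le> V - W \<le> V + \<kappa>W \<le> (U + \<bar>\<kappa>\<bar>) W\<close>. Here \<open>W\<close> is bounded because the diagonal entries are
  \<open>O(1/n)\<close>, and \<open>Tr A\<^sup>2\<close> is bounded below by applying the Cauchy-Schwarz inequality twice.
\<close>

section \<open>Traces, determinants and eigenvalues counted with multiplicity\<close>

lemma mat_trace_mult:
  assumes "A \<in> carrier_mat n m" "B \<in> carrier_mat m n"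
  shows "mat_trace (A * B) = (\<Sum>i<n. \<Sum>k<m. A $$ (i, k) * B $$ (k, i))"
  using assms unfolding mat_trace_def scalar_prod_def
  by (auto simp: scalar_prod_def atLeast0LessThan intro!: sum.cong)

lemma mat_trace_mult_commute:
  fixes A B :: "'a :: comm_semiring_0 mat"
  assumes "A \<in> carrier_mat n m" "B \<in> carrier_mat m n"
  shows "mat_trace (A * B) = mat_trace (B * A)"
  unfolding mat_trace_mult[OF assms] mat_trace_mult[OF assms(2,1)]
  by (subst sum.swap) (simp add: mult.commute)

lemma mat_trace_similar:
  fixes A B :: "'a :: comm_ring_1 mat"
  assumes "similar_mat_wit A B P Q" "A \<in> carrier_mat n n"
  shows "mat_trace A = mat_trace B"
proof -
  note sim = similar_mat_witD2[OF assms(2,1)]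
  have "mat_trace A = mat_trace (P * (B * Q))"
    using sim by (simp add: assoc_mult_mat[of P n n B n Q n])
  also have "\<dots> = mat_trace (B * Q * P)"
    using sim by (intro mat_trace_mult_commute) auto
  also have "B * Q * P = B"
    using sim by (simp add: assoc_mult_mat[of B n n Q n P n])
  finally show ?thesis .
qed

text \<open>In the sum for a diagonal entry of the square, every term with \<open>k\<close>
  different from \<open>i\<close> contains a factor below the diagonal.\<close>

lemma upper_triangular_square_diag:
  fixes B :: "'a :: comm_ring_1 mat"
  assumes "B \<in> carrier_mat n n" "upper_triangular B" "i < n"
  shows "(B * B) $$ (i, i) = (B $$ (i, i))\<^sup>2"
proof -
  have "(B * B) $$ (i, i) = (\<Sum>k<n. B $$ (i, k) * B $$ (k, i))"
    using assms by (auto simp: scalar_prod_def atLeast0LessThan intro!: sum.cong)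
  also have "\<dots> = (\<Sum>k<n. if k = i then (B $$ (i, i))\<^sup>2 else 0)"
  proof (intro sum.cong refl)
    fix k assume "k \<in> {..<n}"
    then show "B $$ (i, k) * B $$ (k, i) = (if k = i then (B $$ (i, i))\<^sup>2 else 0)"
      using assms upper_triangularD[OF assms(2), of k i] upper_triangularD[OF assms(2), of i k]
      by (cases k i rule: linorder_cases) (auto simp: power2_eq_square)
  qed
  also have "\<dots> = (B $$ (i, i))\<^sup>2"
    using assms(3) by simp
  finally show ?thesis .
qed

text \<open>A Schur decomposition makes \<open>A\<close> similar to an upper triangular matrix whose
  diagonal lists the roots of the characteristic polynomial. Traces are invariant under similarity,
  and the determinant is the characteristic polynomial at 1. A list, not a set, keeps track of
  algebraic multiplicity.\<close>

lemma complex_eigenvalue_list: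
  fixes A :: "complex mat"
  assumes A: "A \<in> carrier_mat n n"
  obtains es where "\<And>e. e \<in> set es \<Longrightarrow> eigenvalue A e"
    and "det (1\<^sub>m n - A) = (\<Prod>e\<leftarrow>es. 1 - e)"
    and "mat_trace A = sum_list es"
    and "mat_trace (A * A) = (\<Sum>e\<leftarrow>es. e\<^sup>2)"
proof -
  obtain es where es: "char_poly A = (\<Prod>e\<leftarrow>es. [:- e, 1:])"
    using char_poly_factorized[OF A] by blast
  obtain B P Q where "schur_decomposition A es = (B, P, Q)"
    by (cases "schur_decomposition A es") auto
  from schur_decomposition[OF A es this]
  have sim: "similar_mat_wit A B P Q" and ut: "upper_triangular B" and diag: "diag_mat B = es"
    by auto
  note simD = similar_mat_witD2[OF A sim]
  have trace_list: "mat_trace M = sum_list (diag_mat M)" for M :: "complex mat"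
    by (simp add: mat_trace_def diag_mat_def sum_list_sum_nth atLeast0LessThan)
  have "eigenvalue A e" if "e \<in> set es" for e
    unfolding eigenvalue_root_char_poly[OF A] es using that by (rule linear_poly_root)
  moreover have "det (1\<^sub>m n - A) = (\<Prod>e\<leftarrow>es. 1 - e)"
  proof -
    have "1\<^sub>m n - A = - char_matrix A 1"
      using A by (intro eq_matI) (auto simp: char_matrix_def)
    then have "det (1\<^sub>m n - A) = poly (char_poly A) 1"
      by (simp add: char_poly_matrix[OF A])
    also have "\<dots> = (\<Prod>e\<leftarrow>es. 1 - e)"
      unfolding es poly_prod_list by (simp add: o_def)
    finally show ?thesis .
  qed
  moreover have "mat_trace A = sum_list es"
    using trace_list[of B] unfolding mat_trace_similar[OF sim A] diag .
  moreover have "mat_trace (A * A) = (\<Sum>e\<leftarrow>es. e\<^sup>2)"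
  proof -
    have "A * A = P * B * (Q * P) * B * Q"
      using simD(3-7) A
      by (simp add: assoc_mult_mat[of _ n n _ n _ n])
    then have "A * A = P * (B * B) * Q"
      using simD by (simp add: assoc_mult_mat[of _ n n _ n _ n])
    then have "similar_mat_wit (A * A) (B * B) P Q"
      using simD by (auto simp: similar_mat_wit_def Let_def)
    then have "mat_trace (A * A) = mat_trace (B * B)"
      using A by (intro mat_trace_similar) auto
    also have "\<dots> = (\<Sum>e\<leftarrow>es. e\<^sup>2)"
      using simD(5) upper_triangular_square_diag[OF simD(5) ut]
      unfolding mat_trace_def diag[symmetric] diag_mat_def
      by (simp add: o_def interv_sum_list_conv_sum_set_nat atLeast0LessThan
          del: index_mult_mat(1))
    finally show ?thesis .
  qed
  ultimately show thesis by (rule that)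
qed

text \<open>If all complex eigenvalues lie on the real line, the complex identities are images of
  real ones under the injective homomorphism \<open>complex_of_real\<close>.\<close>

lemma real_eigenvalue_list:
  fixes A :: "real mat"
  assumes A: "A \<in> carrier_mat n n"
    and ev: "\<And>e. eigenvalue (map_mat complex_of_real A) e \<Longrightarrow> \<exists>x\<in>X. e = complex_of_real x"
  obtains xs where "set xs \<subseteq> X"
    and "det (1\<^sub>m n - A) = (\<Prod>x\<leftarrow>xs. 1 - x)"
    and "mat_trace A = sum_list xs"
    and "mat_trace (A * A) = (\<Sum>x\<leftarrow>xs. x\<^sup>2)"
proof -
  let ?A = "map_mat complex_of_real A"
  have trace_hom: "mat_trace (map_mat complex_of_real M) = complex_of_real (mat_trace M)"
    if "M \<in> carrier_mat n n" for M
    using that by (simp add: mat_trace_def)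
  have "?A \<in> carrier_mat n n"
    using A by simp
  then obtain es where es: "\<And>e. e \<in> set es \<Longrightarrow> eigenvalue ?A e"
    and det: "det (1\<^sub>m n - ?A) = (\<Prod>e\<leftarrow>es. 1 - e)"
    and tr: "mat_trace ?A = sum_list es"
    and tr2: "mat_trace (?A * ?A) = (\<Sum>e\<leftarrow>es. e\<^sup>2)"
    using complex_eigenvalue_list by blast
  define xs where "xs = map Re es"
  have "Re e \<in> X \<and> complex_of_real (Re e) = e" if "e \<in> set es" for e
    using ev[OF es[OF that]] by auto
  then have xs: "set xs \<subseteq> X" "es = map complex_of_real xs"
    by (auto simp: xs_def map_idI)
  have hom_lists: "(\<Prod>e\<leftarrow>map complex_of_real ys. 1 - e) = complex_of_real (\<Prod>x\<leftarrow>ys. 1 - x)"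
    "sum_list (map complex_of_real ys) = complex_of_real (sum_list ys)"
    "(\<Sum>e\<leftarrow>map complex_of_real ys. e\<^sup>2) = complex_of_real (\<Sum>x\<leftarrow>ys. x\<^sup>2)" for ys
    by (induct ys) auto
  have "complex_of_real (det (1\<^sub>m n - A)) = det (map_mat complex_of_real (1\<^sub>m n - A))"
    by (rule of_real_hom.hom_det[symmetric])
  also have "map_mat complex_of_real (1\<^sub>m n - A) = 1\<^sub>m n - ?A"
    using A by (intro eq_matI) auto
  finally have "complex_of_real (det (1\<^sub>m n - A)) = complex_of_real (\<Prod>x\<leftarrow>xs. 1 - x)"
    unfolding det xs(2) by (simp only: hom_lists)
  moreover have "complex_of_real (mat_trace A) = complex_of_real (sum_list xs)"
    unfolding trace_hom[OF A, symmetric] tr xs(2) by (simp only: hom_lists)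
  moreover have "complex_of_real (mat_trace (A * A)) = complex_of_real (\<Sum>x\<leftarrow>xs. x\<^sup>2)"
  proof -
    have "complex_of_real (mat_trace (A * A)) = mat_trace (?A * ?A)"
      using trace_hom[of "A * A"] A by (simp only: of_real_hom.mat_hom_mult[OF A A] mult_carrier_mat)
    then show ?thesis
      unfolding tr2 xs(2) by (simp only: hom_lists)
  qed
  ultimately show thesis
    using xs(1) by (intro that[of xs]) (simp_all only: of_real_eq_iff)
qed

section \<open>Logarithm estimates and their sum over a spectrum\<close>

text \<open>The difference of the two sides vanishes at 0 and has derivative
  \<open>y\<^sup>2 / (1 - y)\<close>. The quadratic term is kept because it alone survives when the
  linear term is cancelled, as happens for \<kappa> = -1.\<close>

lemma neg_ln_one_minus_lower:
  fixes x :: real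
  assumes "0 \<le> x" "x < 1"
  shows "x + x\<^sup>2 / 2 \<le> - ln (1 - x)"
proof -
  let ?f = "\<lambda>y::real. - ln (1 - y) - y - y\<^sup>2 / 2"
  have "?f 0 \<le> ?f x"
  proof (rule DERIV_nonneg_imp_nondecreasing[OF assms(1)])
    fix y :: real assume "0 \<le> y" "y \<le> x"
    then have "y < 1" using assms by simp
    then have "(?f has_real_derivative (y\<^sup>2 / (1 - y))) (at y)"
      by (auto intro!: derivative_eq_intros simp: field_simps power2_eq_square)
    then show "\<exists>z. (?f has_real_derivative z) (at y) \<and> 0 \<le> z"
      using \<open>y < 1\<close> by (intro exI[of _ "y\<^sup>2 / (1 - y)"]) simp
  qed
  then show ?thesis by simp
qed

text \<open>This is \<open>ln y \<le> y - 1\<close> at \<open>y = 1 / (1 - x)\<close>. The bound is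
  linear in \<open>x\<close>, so that summing over eigenvalues yields a multiple of the
  trace.\<close>

lemma neg_ln_one_minus_upper:
  fixes x q :: real
  assumes "0 \<le> x" "x \<le> q" "q < 1"
  shows "- ln (1 - x) \<le> x / (1 - q)"
proof -
  have "- ln (1 - x) = ln (1 / (1 - x))"
    using assms by (simp add: ln_div)
  also have "\<dots> \<le> 1 / (1 - x) - 1"
    using assms by (intro ln_le_minus_one) simp
  also have "\<dots> = x / (1 - x)"
    using assms by (simp add: field_simps)
  also have "\<dots> \<le> x / (1 - q)"
    using assms by (intro divide_left_mono mult_pos_pos) auto
  finally show ?thesis .
qed

text \<open>All factors \<open>1 - x\<close> of the determinant are positive, so its logarithm
  splits into a sum over the eigenvalues, to which the two scalar estimates apply term by
  term.\<close>

lemma det_one_minus_bounds: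
  fixes A :: "real mat"
  assumes A: "A \<in> carrier_mat n n" and q: "q < 1"
    and ev: "\<And>e. eigenvalue (map_mat complex_of_real A) e \<Longrightarrow> \<exists>x\<in>{0..q}. e = complex_of_real x"
  shows "0 < det (1\<^sub>m n - A)"
    and "mat_trace A + mat_trace (A * A) / 2 \<le> - ln (det (1\<^sub>m n - A))"
    and "- ln (det (1\<^sub>m n - A)) \<le> mat_trace A / (1 - q)"
proof -
  obtain xs where xs: "set xs \<subseteq> {0..q}"
    and eqs: "det (1\<^sub>m n - A) = (\<Prod>x\<leftarrow>xs. 1 - x)" "mat_trace A = sum_list xs"
      "mat_trace (A * A) = (\<Sum>x\<leftarrow>xs. x\<^sup>2)"
    using real_eigenvalue_list[OF A ev] by blast
  have "0 < (\<Prod>x\<leftarrow>xs. 1 - x) \<and> - ln (\<Prod>x\<leftarrow>xs. 1 - x) = (\<Sum>x\<leftarrow>xs. - ln (1 - x))"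
    using xs q by (induct xs) (auto simp: ln_mult)
  moreover have "sum_list xs + (\<Sum>x\<leftarrow>xs. x\<^sup>2) / 2 \<le> (\<Sum>x\<leftarrow>xs. - ln (1 - x))"
    using xs
  proof (induct xs)
    case (Cons x xs)
    then show ?case
      using neg_ln_one_minus_lower[of x] q by (simp add: add_divide_distrib)
  qed simp
  moreover have "(\<Sum>x\<leftarrow>xs. - ln (1 - x)) \<le> sum_list xs / (1 - q)"
    using xs
  proof (induct xs)
    case (Cons x xs)
    then show ?case
      using neg_ln_one_minus_upper[of x q] q by (simp add: add_divide_distrib)
  qed simp
  ultimately show "0 < det (1\<^sub>m n - A)"
    and "mat_trace A + mat_trace (A * A) / 2 \<le> - ln (det (1\<^sub>m n - A))"
    and "- ln (det (1\<^sub>m n - A)) \<le> mat_trace A / (1 - q)"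
    unfolding eqs by auto
qed

section \<open>Spectrum of a positive diagonal matrix times a Gram matrix\<close>

text \<open>Let \<open>A\<close> be \<open>D\<close> times a Gram matrix, where \<open>D\<close> is
  diagonal with entries \<open>d\<close>. Dividing the eigenvector equation by \<open>D\<close> and
  pairing it with the eigenvector makes \<open>e\<close> a quotient of nonnegative quadratic forms.
  The bound by \<open>q\<close> comes from the weighted column sums of the nonnegative matrix
  \<open>A\<close>.\<close>

lemma eigenvalue_diag_gram:
  fixes A :: "real mat" and d w :: "nat \<Rightarrow> real" and g :: "nat \<Rightarrow> nat \<Rightarrow> real"
  assumes A: "A \<in> carrier_mat n n"
    and gram: "\<And>l m. l < n \<Longrightarrow> m < n \<Longrightarrow> A $$ (l, m) = d l * (\<Sum>i<N. g i l * g i m)"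
    and d: "\<And>l. l < n \<Longrightarrow> 0 < d l"
    and nonneg: "\<And>l m. l < n \<Longrightarrow> m < n \<Longrightarrow> 0 \<le> A $$ (l, m)"
    and w: "\<And>l. l < n \<Longrightarrow> 0 < w l"
    and col: "\<And>m. m < n \<Longrightarrow> (\<Sum>l<n. w l * A $$ (l, m)) \<le> q * w m"
    and e: "eigenvalue (map_mat complex_of_real A) e"
  shows "\<exists>x\<in>{0..q}. e = complex_of_real x"
proof -
  obtain v where v: "v \<in> carrier_vec n" "v \<noteq> 0\<^sub>v n"
    and Av: "map_mat complex_of_real A *\<^sub>v v = e \<cdot>\<^sub>v v"
    using e A unfolding eigenvalue_def eigenvector_def by auto
  define y where "y l = vec_index v l" for l
  have eq: "(\<Sum>m<n. complex_of_real (A $$ (l, m)) * y m) = e * y l" if "l < n" for l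
  proof -
    have "vec_index (map_mat complex_of_real A *\<^sub>v v) l = vec_index (e \<cdot>\<^sub>v v) l"
      unfolding Av ..
    then show ?thesis
      using that A v(1) by (simp add: scalar_prod_def atLeast0LessThan y_def)
  qed
  obtain k where k: "k < n" "y k \<noteq> 0"
    using v by (metis carrier_vecD eq_vecI index_zero_vec y_def)
  \<comment> \<open>For the eigenvector \<open>y\<close>, \<open>r\<close> is the quadratic form of
    the inverse of the diagonal factor, and \<open>h\<close> is that of the Gram matrix, written as
    a sum of squared moduli. The goal is \<open>e * r = h\<close>.\<close>
  define r where "r = (\<Sum>l<n. (cmod (y l))\<^sup>2 / d l)"
  define h where "h = (\<Sum>i<N. (cmod (\<Sum>l<n. complex_of_real (g i l) * y l))\<^sup>2)"
  have "0 < (cmod (y k))\<^sup>2 / d k"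
    using k d by simp
  also have "\<dots> \<le> r"
    unfolding r_def using k d by (intro member_le_sum) (auto simp: less_imp_le)
  finally have "0 < r" .
  have "e * complex_of_real r = (\<Sum>l<n. cnj (y l) * (e * y l) / complex_of_real (d l))"
    by (simp add: r_def sum_distrib_left complex_norm_square mult_ac del: of_real_power)
  also have "\<dots> = (\<Sum>l<n. cnj (y l) * (\<Sum>m<n. complex_of_real (\<Sum>i<N. g i l * g i m) * y m))"
  proof (intro sum.cong refl)
    fix l assume "l \<in> {..<n}"
    then have l: "l < n" by simp
    have "e * y l = complex_of_real (d l) * (\<Sum>m<n. complex_of_real (\<Sum>i<N. g i l * g i m) * y m)"
      unfolding eq[OF l, symmetric] sum_distrib_left
      by (intro sum.cong refl) (simp add: gram l mult.assoc)
    then show "cnj (y l) * (e * y l) / complex_of_real (d l) =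
        cnj (y l) * (\<Sum>m<n. complex_of_real (\<Sum>i<N. g i l * g i m) * y m)"
      using d[OF l] by simp
  qed
  also have "\<dots> = (\<Sum>l<n. \<Sum>m<n. \<Sum>i<N. cnj (y l) * complex_of_real (g i l) * (complex_of_real (g i m) * y m))"
    by (simp add: sum_distrib_left sum_distrib_right mult.assoc)
  also have "\<dots> = (\<Sum>l<n. \<Sum>i<N. \<Sum>m<n. cnj (y l) * complex_of_real (g i l) * (complex_of_real (g i m) * y m))"
    by (intro sum.cong refl sum.swap)
  also have "\<dots> = (\<Sum>i<N. \<Sum>l<n. \<Sum>m<n. cnj (y l) * complex_of_real (g i l) * (complex_of_real (g i m) * y m))"
    by (rule sum.swap)
  also have "\<dots> = (\<Sum>i<N. (\<Sum>l<n. cnj (y l) * complex_of_real (g i l)) * (\<Sum>m<n. complex_of_real (g i m) * y m))"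
    by (simp add: sum_product)
  \<comment> \<open>Since \<open>g\<close> is real, the first factor is the conjugate of the
    second.\<close>
  also have "\<dots> = complex_of_real h"
    unfolding h_def of_real_sum complex_norm_square cnj_sum
    by (intro sum.cong refl) (simp add: mult.commute)
  finally have "e = complex_of_real (h / r)"
    using \<open>0 < r\<close> by (simp add: field_simps)
  moreover have "0 \<le> h / r"
    using \<open>0 < r\<close> by (simp add: h_def sum_nonneg)
  moreover have "h / r \<le> q"
  proof -
    \<comment> \<open>\<open>s\<close> is the l1 norm of \<open>y\<close> with weights
      \<open>w\<close>. The triangle inequality and the column bound show that \<open>A\<close>
      contracts this norm by the factor \<open>q\<close>.\<close>
    define s where "s = (\<Sum>l<n. w l * cmod (y l))"
    have "0 < w k * cmod (y k)"
      using k w by simp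
    also have "\<dots> \<le> s"
      unfolding s_def using k w by (intro member_le_sum) (auto simp: less_imp_le)
    finally have "0 < s" .
    have "cmod e * s = (\<Sum>l<n. w l * cmod (e * y l))"
      by (simp add: s_def sum_distrib_left norm_mult mult_ac)
    also have "\<dots> \<le> (\<Sum>l<n. w l * (\<Sum>m<n. A $$ (l, m) * cmod (y m)))"
    proof (intro sum_mono mult_left_mono)
      fix l assume "l \<in> {..<n}"
      then have l: "l < n" by simp
      show "cmod (e * y l) \<le> (\<Sum>m<n. A $$ (l, m) * cmod (y m))"
        unfolding eq[OF l, symmetric] using nonneg l
        by (intro order_trans[OF norm_sum] sum_mono) (simp add: norm_mult)
      show "0 \<le> w l" using w[OF l] by simp
    qed
    also have "\<dots> = (\<Sum>m<n. (\<Sum>l<n. w l * A $$ (l, m)) * cmod (y m))"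
      unfolding sum_distrib_left sum_distrib_right mult.assoc by (rule sum.swap)
    also have "\<dots> \<le> (\<Sum>m<n. q * w m * cmod (y m))"
      using col by (intro sum_mono mult_right_mono) auto
    also have "\<dots> = q * s"
      by (simp add: s_def sum_distrib_left mult.assoc)
    finally have "cmod e \<le> q"
      using \<open>0 < s\<close> by simp
    then show ?thesis
      by (simp only: \<open>e = complex_of_real (h / r)\<close> norm_of_real abs_of_nonneg[OF \<open>0 \<le> h / r\<close>])
  qed
  ultimately show ?thesis
    by (intro bexI[of _ "h / r"]) auto
qed

section \<open>Estimates in a fixed dimension, with constants independent of it\<close>

text \<open>The real system at \<open>z = - \<rho>\<close> for a single \<open>n\<close>:
  \<open>a i j\<close> stands for the squared \<sigma>, and \<open>\<tau> i\<close> for the value of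
  \<open>t i\<close> at \<open>- \<rho>\<close>. The dimensions enter the final bounds only through
  \<open>K\<close>, which dominates the ratio of \<open>N\<close> to \<open>n\<close>.\<close>

locale variance_profile =
  fixes N n :: nat and a :: "nat \<Rightarrow> nat \<Rightarrow> real" and \<tau> :: "nat \<Rightarrow> real" and \<rho> S K :: real
  assumes n_pos: "0 < n" and \<rho>_pos: "0 < \<rho>"
    and N_pos: "0 < N" and N_le: "real N \<le> K * real n"
    and a_nonneg: "i < N \<Longrightarrow> j < n \<Longrightarrow> 0 \<le> a i j"
    and a_le: "i < N \<Longrightarrow> j < n \<Longrightarrow> a i j \<le> S"
    and \<tau>_nonneg: "i < N \<Longrightarrow> 0 \<le> \<tau> i"
    and \<tau>_eq: "i < N \<Longrightarrow>
      \<tau> i = 1 / (\<rho> + 1 / n * (\<Sum>j<n. a i j / (1 + 1 / n * (\<Sum>l<N. a l j * \<tau> l))))"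
begin

definition u :: "nat \<Rightarrow> real" where
  "u j = 1 + 1 / n * (\<Sum>i<N. a i j * \<tau> i)"

definition \<alpha> :: "nat \<Rightarrow> nat \<Rightarrow> real" where
  "\<alpha> l m = 1 / n * ((1 / n * (\<Sum>i<N. a i l * a i m * (\<tau> i)\<^sup>2)) / (u l)\<^sup>2)"

definition A :: "real mat" where
  "A = Matrix.mat n n (\<lambda>(l, m). \<alpha> l m)"

text \<open>An upper bound for every \<open>u j\<close>, obtained from \<open>a i j \<le> S\<close>,
  \<open>\<tau> i \<le> 1 / \<rho>\<close> and \<open>N \<le> K * n\<close>.\<close>

definition U :: real where
  "U = 1 + K * (S / \<rho>)"

lemma S_nonneg: "0 \<le> S"
  using a_nonneg[OF N_pos n_pos] a_le[OF N_pos n_pos] by simp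

lemma K_pos: "0 < K"
proof -
  have "0 < K * real n"
    using N_pos N_le by (auto intro: order_less_le_trans[of 0 "real N"])
  then show ?thesis
    using n_pos by (simp add: zero_less_mult_iff)
qed

lemma U_ge_1: "1 \<le> U"
  using S_nonneg K_pos \<rho>_pos by (simp add: U_def)

lemma u_ge_1: "j < n \<Longrightarrow> 1 \<le> u j"
  using a_nonneg \<tau>_nonneg by (auto simp: u_def intro!: divide_nonneg_nonneg sum_nonneg)

lemma \<tau>_eq_u: "i < N \<Longrightarrow> \<tau> i = 1 / (\<rho> + 1 / n * (\<Sum>j<n. a i j / u j))"
  using \<tau>_eq unfolding u_def .

lemma a_div_u_bounds:
  assumes "i < N" "j < n"
  shows "0 \<le> a i j / u j" "a i j / u j \<le> S"
proof -
  show "0 \<le> a i j / u j"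
    using a_nonneg u_ge_1 assms by (intro divide_nonneg_nonneg) (auto intro: order_trans[of 0 1])
  have "a i j / u j \<le> a i j / 1"
    using a_nonneg u_ge_1[OF assms(2)] assms by (intro divide_left_mono) auto
  then show "a i j / u j \<le> S"
    using a_le[OF assms] by simp
qed

text \<open>The average of the quotients \<open>a i j / u j\<close> lies between 0 and
  \<open>S\<close>, so the denominator of \<open>\<tau> i\<close> lies between \<open>\<rho>\<close>
  and \<open>\<rho> + S\<close>.\<close>

lemma \<tau>_bounds:
  assumes "i < N"
  shows "1 / (\<rho> + S) \<le> \<tau> i" "\<tau> i \<le> 1 / \<rho>"
proof -
  let ?s = "1 / n * (\<Sum>j<n. a i j / u j)"
  have "0 \<le> ?s"
    using a_div_u_bounds[OF assms] by (intro mult_nonneg_nonneg sum_nonneg) auto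
  moreover have "?s \<le> 1 / n * (\<Sum>j<n. S)"
    using a_div_u_bounds[OF assms] by (intro mult_left_mono sum_mono) auto
  then have "?s \<le> S"
    using n_pos by simp
  ultimately show "1 / (\<rho> + S) \<le> \<tau> i" "\<tau> i \<le> 1 / \<rho>"
    unfolding \<tau>_eq_u[OF assms] using \<rho>_pos by (auto intro!: divide_left_mono)
qed

lemma \<tau>_pos: "i < N \<Longrightarrow> 0 < \<tau> i"
  using \<tau>_bounds(1)[of i] S_nonneg \<rho>_pos by (smt (verit) divide_pos_pos)

text \<open>There are \<open>N\<close> terms but the normalization is by \<open>n\<close>, hence the
  factor \<open>K\<close>.\<close>

lemma normalized_sum_le:
  assumes "\<And>i. i < N \<Longrightarrow> f i \<le> C" and "0 \<le> C"
  shows "1 / real n * (\<Sum>i<N. f i) \<le> K * C"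
proof -
  have "(\<Sum>i<N. f i) \<le> (\<Sum>i<N. C)"
    using assms by (intro sum_mono) auto
  also have "\<dots> \<le> K * real n * C"
    using N_le assms(2) by (simp add: mult_right_mono)
  finally show ?thesis
    using n_pos by (simp add: field_simps)
qed

lemma u_le_U: "j < n \<Longrightarrow> u j \<le> U"
  unfolding u_def U_def
proof (intro add_left_mono normalized_sum_le)
  fix i assume "i < N" "j < n"
  then have "a i j * \<tau> i \<le> S * (1 / \<rho>)"
    using a_nonneg a_le \<tau>_bounds \<tau>_nonneg S_nonneg by (intro mult_mono) auto
  then show "a i j * \<tau> i \<le> S / \<rho>" by simp
qed (use S_nonneg \<rho>_pos in auto)

lemma \<alpha>_nonneg: "l < n \<Longrightarrow> m < n \<Longrightarrow> 0 \<le> \<alpha> l m"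
  using a_nonneg by (auto simp: \<alpha>_def intro!: mult_nonneg_nonneg divide_nonneg_nonneg sum_nonneg)

text \<open>Multiplying the equation for \<open>\<tau> i\<close> by \<open>a i m * (\<tau> i)\<^sup>2\<close> and averaging over \<open>i\<close> shows
  that \<open>u\<close> is a strictly subinvariant left vector of \<open>A\<close>.\<close>

lemma u_subinvariant:
  assumes m: "m < n"
  shows "(\<Sum>l<n. u l * \<alpha> l m) \<le> u m - 1"
proof -
  have "1 / n * (a i m * \<tau> i) =
      \<rho> * (1 / n * (a i m * (\<tau> i)\<^sup>2)) + (\<Sum>l<n. u l * (1 / n * (1 / n * (a i l * a i m * (\<tau> i)\<^sup>2) / (u l)\<^sup>2)))"
    if i: "i < N" for i
  proof -
    have "(\<Sum>l<n. u l * (1 / n * (1 / n * (a i l * a i m * (\<tau> i)\<^sup>2) / (u l)\<^sup>2))) =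
        (\<Sum>l<n. 1 / n * (a i m * (\<tau> i)\<^sup>2) * (1 / n * (a i l / u l)))"
    proof (intro sum.cong refl)
      fix l assume "l \<in> {..<n}"
      then have "u l \<noteq> 0" using u_ge_1[of l] by auto
      then show "u l * (1 / n * (1 / n * (a i l * a i m * (\<tau> i)\<^sup>2) / (u l)\<^sup>2)) =
          1 / n * (a i m * (\<tau> i)\<^sup>2) * (1 / n * (a i l / u l))"
        by (simp add: power2_eq_square)
    qed
    then have sum_eq: "(\<Sum>l<n. u l * (1 / n * (1 / n * (a i l * a i m * (\<tau> i)\<^sup>2) / (u l)\<^sup>2))) =
        1 / n * (a i m * (\<tau> i)\<^sup>2) * (1 / n * (\<Sum>l<n. a i l / u l))"
      by (simp only: sum_distrib_left)
    have "\<tau> i * (\<rho> + 1 / n * (\<Sum>l<n. a i l / u l)) = 1"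
      using \<tau>_eq_u[OF i] \<tau>_pos[OF i] by (metis eq_divide_eq less_irrefl nonzero_mult_div_cancel_left times_divide_eq_right zero_less_divide_1_iff)
    then have "1 / n * (a i m * \<tau> i) = 1 / n * (a i m * \<tau> i) * (\<tau> i * (\<rho> + 1 / n * (\<Sum>l<n. a i l / u l)))"
      by (simp only: mult_1_right)
    also have "\<dots> = \<rho> * (1 / n * (a i m * (\<tau> i)\<^sup>2)) +
        1 / n * (a i m * (\<tau> i)\<^sup>2) * (1 / n * (\<Sum>l<n. a i l / u l))"
      by (simp only: power2_eq_square distrib_left mult_ac)
    finally show ?thesis
      unfolding sum_eq .
  qed
  then have "u m - 1 = (\<Sum>i<N. \<rho> * (1 / n * (a i m * (\<tau> i)\<^sup>2)) +
      (\<Sum>l<n. u l * (1 / n * (1 / n * (a i l * a i m * (\<tau> i)\<^sup>2) / (u l)\<^sup>2))))"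
    unfolding u_def add_diff_cancel_left' sum_distrib_left by (intro sum.cong) auto
  also have "\<dots> = (\<Sum>i<N. \<rho> * (1 / n * (a i m * (\<tau> i)\<^sup>2))) + (\<Sum>l<n. u l * \<alpha> l m)"
    unfolding sum.distrib \<alpha>_def sum_distrib_left sum_divide_distrib
    by (rule arg_cong[where f = "(+) _"], rule sum.swap)
  \<comment> \<open>The \<rho>-term is exactly the gap in the claimed inequality, and it is
    nonnegative.\<close>
  moreover have "0 \<le> (\<Sum>i<N. \<rho> * (1 / n * (a i m * (\<tau> i)\<^sup>2)))"
    using a_nonneg m \<rho>_pos by (intro sum_nonneg mult_nonneg_nonneg) auto
  ultimately show ?thesis
    by linarith
qed

lemma A_carrier: "A \<in> carrier_mat n n"
  by (simp add: A_def)

text \<open>The diagonal factor has entries \<open>1 / (n * u l)\<^sup>2\<close>, the Gram vectors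
  have entries \<open>a i l * \<tau> i\<close>, and the column weights are \<open>u\<close>.\<close>

lemma eigenvalue_A:
  assumes "eigenvalue (map_mat complex_of_real A) e"
  shows "\<exists>x\<in>{0..1 - 1 / U}. e = complex_of_real x"
proof (rule eigenvalue_diag_gram[OF A_carrier _ _ _ _ _ assms])
  fix l m assume l: "l < n" and m: "m < n"
  show "A $$ (l, m) = 1 / (real n * u l)\<^sup>2 * (\<Sum>i<N. (a i l * \<tau> i) * (a i m * \<tau> i))"
    using l m by (simp add: A_def \<alpha>_def power2_eq_square mult_ac)
  show "0 \<le> A $$ (l, m)"
    using l m \<alpha>_nonneg by (simp add: A_def)
next
  fix l assume "l < n"
  then show "0 < 1 / (real n * u l)\<^sup>2" "0 < u l"
    using u_ge_1[of l] n_pos by auto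
next
  fix m assume m: "m < n"
  have "(\<Sum>l<n. u l * A $$ (l, m)) = (\<Sum>l<n. u l * \<alpha> l m)"
    using m by (simp add: A_def)
  also have "\<dots> \<le> u m - 1"
    by (rule u_subinvariant[OF m])
  \<comment> \<open>Equivalent to \<open>u m / U \<le> 1\<close>: the additive gap 1 becomes a
    multiplicative one because \<open>u\<close> is bounded.\<close>
  also have "\<dots> \<le> (1 - 1 / U) * u m"
    using u_le_U[OF m] U_ge_1 by (simp add: field_simps)
  finally show "(\<Sum>l<n. u l * A $$ (l, m)) \<le> (1 - 1 / U) * u m" .
qed

text \<open>Each of the \<open>n\<close> diagonal entries is at most
  \<open>K * (S / \<rho>)\<^sup>2 / n\<close>, since \<open>u l\<close> is at least 1.\<close>

lemma trace_A_bounds: "0 \<le> mat_trace A" "mat_trace A \<le> K * (S / \<rho>)\<^sup>2"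
proof -
  have tr: "mat_trace A = (\<Sum>l<n. \<alpha> l l)"
    unfolding mat_trace_def A_def by (intro sum.cong) auto
  show "0 \<le> mat_trace A"
    unfolding tr using \<alpha>_nonneg by (intro sum_nonneg) auto
  have "\<alpha> l l \<le> 1 / n * (K * (S / \<rho>)\<^sup>2)" if l: "l < n" for l
  proof -
    have "1 / n * (\<Sum>i<N. a i l * a i l * (\<tau> i)\<^sup>2) \<le> K * (S / \<rho>)\<^sup>2"
    proof (rule normalized_sum_le)
      fix i assume i: "i < N"
      have "a i l * \<tau> i \<le> S * (1 / \<rho>)"
        using i l a_nonneg a_le \<tau>_bounds \<tau>_nonneg S_nonneg by (intro mult_mono) auto
      then have "(a i l * \<tau> i)\<^sup>2 \<le> (S / \<rho>)\<^sup>2"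
        using i l a_nonneg \<tau>_nonneg by (intro power_mono) auto
      then show "a i l * a i l * (\<tau> i)\<^sup>2 \<le> (S / \<rho>)\<^sup>2"
        by (simp add: power2_eq_square mult_ac)
    qed simp
    moreover have "1 \<le> (u l)\<^sup>2"
      using u_ge_1[OF l] by simp
    ultimately have "1 / n * (\<Sum>i<N. a i l * a i l * (\<tau> i)\<^sup>2) / (u l)\<^sup>2 \<le> K * (S / \<rho>)\<^sup>2 / 1"
      using K_pos by (intro frac_le) auto
    then show ?thesis
      unfolding \<alpha>_def by (intro mult_left_mono) auto
  qed
  then have "mat_trace A \<le> (\<Sum>l<n. 1 / n * (K * (S / \<rho>)\<^sup>2))"
    unfolding tr by (intro sum_mono) auto
  then show "mat_trace A \<le> K * (S / \<rho>)\<^sup>2"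
    using n_pos by simp
qed

text \<open>The total mass \<open>R\<close> of the profile is at least of order
  \<open>n\<^sup>2\<close>. One Cauchy-Schwarz inequality passes from \<open>R\<close> to the
  weighted row sums in \<open>?H\<close>, and a second one from \<open>?H\<close> to the squares of
  the entries \<open>G l m\<close>, which are controlled by the products
  \<open>\<alpha> l m * \<alpha> m l\<close>.\<close>

lemma trace_A_square_lower:
  assumes \<mu>: "0 \<le> \<mu>" "\<mu> * (real n)\<^sup>2 \<le> (\<Sum>j<n. \<Sum>i<N. a i j)"
  shows "\<mu> ^ 4 / ((\<rho> + S) ^ 4 * K\<^sup>2 * U ^ 4) \<le> mat_trace (A * A)"
proof -
  define G where "G l m = (\<Sum>i<N. a i l * a i m * (\<tau> i)\<^sup>2)" for l m
  define b where "b i = (\<Sum>j<n. a i j)" for i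
  define R where "R = (\<Sum>j<n. \<Sum>i<N. a i j)"
  let ?H = "\<Sum>i<N. (\<tau> i)\<^sup>2 * (b i)\<^sup>2"
  have n: "0 < real n" and N: "0 < real N"
    using n_pos N_pos by auto
  have RS: "0 < \<rho> + S"
    using \<rho>_pos S_nonneg by simp
  have R: "R = (\<Sum>i<N. b i)"
    unfolding R_def b_def by (rule sum.swap)
  \<comment> \<open>Cauchy-Schwarz over the \<open>N\<close> rows. The lower bound on
    \<open>\<tau> i\<close> then inserts the weights \<open>(\<tau> i)\<^sup>2\<close>.\<close>
  have "R\<^sup>2 \<le> (\<Sum>i<N. (b i)\<^sup>2) * N"
    unfolding R using sum_squared_le_sum_of_squares[of b "{..<N}"] by simp
  also have "\<dots> \<le> (\<Sum>i<N. (\<rho> + S)\<^sup>2 * ((\<tau> i)\<^sup>2 * (b i)\<^sup>2)) * N"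
  proof (intro mult_right_mono sum_mono)
    fix i assume "i \<in> {..<N}"
    then have "1 \<le> (\<rho> + S) * \<tau> i"
      using \<tau>_bounds(1)[of i] RS by (simp add: divide_le_eq mult.commute)
    then have "1 \<le> ((\<rho> + S) * \<tau> i)\<^sup>2"
      by simp
    then show "(b i)\<^sup>2 \<le> (\<rho> + S)\<^sup>2 * ((\<tau> i)\<^sup>2 * (b i)\<^sup>2)"
      using mult_right_mono[of 1 "((\<rho> + S) * \<tau> i)\<^sup>2" "(b i)\<^sup>2"] by (simp add: power_mult_distrib mult_ac)
  qed simp
  also have "\<dots> = (\<rho> + S)\<^sup>2 * ?H * N"
    by (simp add: sum_distrib_left)
  also have "\<dots> \<le> (\<rho> + S)\<^sup>2 * ?H * (K * n)"
    using N_le by (intro mult_left_mono mult_nonneg_nonneg sum_nonneg) auto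
  finally have R_le: "R\<^sup>2 \<le> (\<rho> + S)\<^sup>2 * ?H * (K * n)" .
  have "?H = (\<Sum>i<N. \<Sum>l<n. \<Sum>m<n. a i l * a i m * (\<tau> i)\<^sup>2)"
    by (simp add: b_def power2_eq_square sum_product sum_distrib_left mult_ac)
  also have "\<dots> = (\<Sum>l<n. \<Sum>i<N. \<Sum>m<n. a i l * a i m * (\<tau> i)\<^sup>2)"
    by (rule sum.swap)
  also have "\<dots> = (\<Sum>l<n. \<Sum>m<n. G l m)"
    unfolding G_def by (intro sum.cong refl sum.swap)
  also have "\<dots> = (\<Sum>p\<in>{..<n} \<times> {..<n}. G (fst p) (snd p))"
    by (simp add: sum.cartesian_product case_prod_beta)
  finally have H: "?H = (\<Sum>p\<in>{..<n} \<times> {..<n}. G (fst p) (snd p))" .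
  \<comment> \<open>Cauchy-Schwarz over the \<open>n\<^sup>2\<close> pairs of column
    indices.\<close>
  have H_square_le: "?H\<^sup>2 \<le> (\<Sum>p\<in>{..<n} \<times> {..<n}. (G (fst p) (snd p))\<^sup>2) * (real n)\<^sup>2"
    unfolding H
    using sum_squared_le_sum_of_squares[of "\<lambda>p. G (fst p) (snd p)" "{..<n} \<times> {..<n}"]
    by (simp add: power2_eq_square)
  have "(\<Sum>p\<in>{..<n} \<times> {..<n}. (G (fst p) (snd p))\<^sup>2) = (\<Sum>l<n. \<Sum>m<n. (G l m)\<^sup>2)"
    by (simp add: sum.cartesian_product case_prod_beta)
  also have "\<dots> \<le> (\<Sum>l<n. \<Sum>m<n. (real n) ^ 4 * U ^ 4 * (\<alpha> l m * \<alpha> m l))"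
  proof (intro sum_mono)
    fix l m assume "l \<in> {..<n}" "m \<in> {..<n}"
    then have l: "l < n" and m: "m < n" by auto
    \<comment> \<open>Symmetry of \<open>G\<close> turns its square into a multiple of
      \<open>\<alpha> l m * \<alpha> m l\<close>, the summand of the trace of
      \<open>A * A\<close>.\<close>
    have "G m l = G l m"
      by (simp add: G_def mult_ac)
    then have "(G l m)\<^sup>2 = (real n) ^ 4 * ((u l)\<^sup>2 * (u m)\<^sup>2) * (\<alpha> l m * \<alpha> m l)"
      using u_ge_1[OF l] u_ge_1[OF m] n
      unfolding \<alpha>_def G_def[symmetric] by (simp add: field_simps power2_eq_square power4_eq_xxxx)
    also have "\<dots> \<le> (real n) ^ 4 * (U\<^sup>2 * U\<^sup>2) * (\<alpha> l m * \<alpha> m l)"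
      using u_ge_1[OF l] u_ge_1[OF m] u_le_U[OF l] u_le_U[OF m] \<alpha>_nonneg l m
      by (intro mult_right_mono mult_left_mono mult_mono power_mono) auto
    finally show "(G l m)\<^sup>2 \<le> (real n) ^ 4 * U ^ 4 * (\<alpha> l m * \<alpha> m l)"
      by (simp flip: power_add)
  qed
  also have "\<dots> = (real n) ^ 4 * U ^ 4 * mat_trace (A * A)"
    unfolding mat_trace_mult[OF A_carrier A_carrier] by (simp add: A_def sum_distrib_left)
  finally have H_le: "?H\<^sup>2 \<le> (real n) ^ 4 * U ^ 4 * mat_trace (A * A) * (real n)\<^sup>2"
    by (intro order_trans[OF H_square_le] mult_right_mono) auto
  \<comment> \<open>Chaining the two inequalities produces the factor \<open>n ^ 8\<close> on both
    sides; cancelling it leaves a bound independent of \<open>n\<close>.\<close>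
  have "\<mu> ^ 4 * (real n) ^ 8 = ((\<mu> * (real n)\<^sup>2)\<^sup>2)\<^sup>2"
    by (simp add: power_mult_distrib)
  also have "\<dots> \<le> (R\<^sup>2)\<^sup>2"
    using \<mu> unfolding R_def by (intro power_mono) auto
  also have "\<dots> \<le> ((\<rho> + S)\<^sup>2 * ?H * (K * n))\<^sup>2"
    using R_le by (intro power_mono) auto
  also have "\<dots> = (\<rho> + S) ^ 4 * K\<^sup>2 * (real n)\<^sup>2 * ?H\<^sup>2"
    by (simp add: power_mult_distrib mult_ac)
  also have "\<dots> \<le> (\<rho> + S) ^ 4 * K\<^sup>2 * (real n)\<^sup>2 * ((real n) ^ 4 * U ^ 4 * mat_trace (A * A) * (real n)\<^sup>2)"
    using H_le by (intro mult_left_mono) auto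
  also have "\<dots> = (\<rho> + S) ^ 4 * K\<^sup>2 * U ^ 4 * mat_trace (A * A) * (real n) ^ 8"
    by (simp add: mult_ac flip: power_add)
  finally have "\<mu> ^ 4 \<le> (\<rho> + S) ^ 4 * K\<^sup>2 * U ^ 4 * mat_trace (A * A)"
    using n by simp
  moreover have "0 < (\<rho> + S) ^ 4 * K\<^sup>2 * U ^ 4"
    using RS K_pos U_ge_1 by simp
  ultimately show ?thesis
    by (simp add: pos_divide_le_eq mult.commute)
qed

lemma det_pos: "0 < det (1\<^sub>m n - A)"
  using det_one_minus_bounds(1)[OF A_carrier _ eigenvalue_A] U_ge_1 by simp

lemma log_det_upper:
  "- ln (det (1\<^sub>m n - A)) + \<kappa> * mat_trace A \<le> (U + \<bar>\<kappa>\<bar>) * (K * (S / \<rho>)\<^sup>2)"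
proof -
  \<comment> \<open>With \<open>q = 1 - 1 / U\<close> the factor \<open>1 / (1 - q)\<close> is
    \<open>U\<close>.\<close>
  have "- ln (det (1\<^sub>m n - A)) \<le> U * mat_trace A"
    using det_one_minus_bounds(3)[OF A_carrier _ eigenvalue_A] U_ge_1 by (simp add: mult.commute)
  moreover have "\<kappa> * mat_trace A \<le> \<bar>\<kappa>\<bar> * mat_trace A"
    using trace_A_bounds(1) by (intro mult_right_mono) auto
  ultimately have "- ln (det (1\<^sub>m n - A)) + \<kappa> * mat_trace A \<le> (U + \<bar>\<kappa>\<bar>) * mat_trace A"
    by (simp add: distrib_right)
  also have "\<dots> \<le> (U + \<bar>\<kappa>\<bar>) * (K * (S / \<rho>)\<^sup>2)"
    using trace_A_bounds U_ge_1 by (intro mult_left_mono) auto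
  finally show ?thesis .
qed

text \<open>Since the trace of \<open>A\<close> is nonnegative, \<kappa> \<ge> -1 removes at most
  the linear part of the logarithm bound. Half the trace of \<open>A * A\<close> remains.\<close>

lemma log_det_lower:
  assumes "0 \<le> \<mu>" "\<mu> * (real n)\<^sup>2 \<le> (\<Sum>j<n. \<Sum>i<N. a i j)" and \<kappa>: "- 1 \<le> \<kappa>"
  shows "\<mu> ^ 4 / ((\<rho> + S) ^ 4 * K\<^sup>2 * U ^ 4) / 2 \<le> - ln (det (1\<^sub>m n - A)) + \<kappa> * mat_trace A"
proof -
  have "mat_trace A + mat_trace (A * A) / 2 \<le> - ln (det (1\<^sub>m n - A))"
    using det_one_minus_bounds(2)[OF A_carrier _ eigenvalue_A] U_ge_1 by simp
  moreover have "- mat_trace A \<le> \<kappa> * mat_trace A"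
    using mult_right_mono[OF \<kappa> trace_A_bounds(1)] by simp
  ultimately show ?thesis
    using trace_A_square_lower[OF assms(1,2)] by simp
qed

end

section \<open>From the matrix definitions to the real fixed-point system\<close>

lemma mat_trace_mat_diag: "mat_trace (mat_diag N f) = (\<Sum>i<N. f i)"
  by (simp add: mat_trace_def mat_diag_def)

lemma T_neg_mat_diag: "T_neg N t \<rho> = mat_diag N (\<lambda>i. Re (t i (complex_of_real (- \<rho>))))"
  unfolding T_neg_def T_mat_def by (intro eq_matI) (auto simp: mat_diag_def)

text \<open>All matrices inside the traces are diagonal, so products are taken entrywise and traces
  become sums over \<open>i\<close>.\<close>

lemma A_mat_eq:
  assumes "variance_profile N n (\<lambda>i j. (s i j)\<^sup>2) (\<lambda>i. Re (t i (complex_of_real (- \<rho>)))) \<rho> S K"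
  shows "A_mat s N n t \<rho> =
    variance_profile.A N n (\<lambda>i j. (s i j)\<^sup>2) (\<lambda>i. Re (t i (complex_of_real (- \<rho>))))"
proof -
  interpret variance_profile N n "\<lambda>i j. (s i j)\<^sup>2" "\<lambda>i. Re (t i (complex_of_real (- \<rho>)))" \<rho> S K
    by (rule assms)
  have "T_neg N t \<rho> ^\<^sub>m 2 = mat_diag N (\<lambda>i. (Re (t i (complex_of_real (- \<rho>))))\<^sup>2)"
    unfolding T_neg_mat_diag by (simp add: numeral_2_eq_2 power2_eq_square)
  then show ?thesis
    unfolding A_mat_def A_def \<alpha>_def u_def D_mat_def
    by (simp add: T_neg_mat_diag mat_trace_mat_diag del: of_real_minus)
qed

text \<open>The point \<open>- \<rho>\<close> lies off the nonnegative axis, and Stieltjes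
  transforms are real and nonnegative there, so the complex system restricts to a real one.\<close>

lemma variance_profile_of_system:
  assumes sol: "solves_system s N n t" and "0 < n" "0 < N" "0 < \<rho>" "real N \<le> K * real n"
    and bound: "\<And>i j. i < N \<Longrightarrow> j < n \<Longrightarrow> \<bar>s i j\<bar> \<le> b"
  shows "variance_profile N n (\<lambda>i j. (s i j)\<^sup>2) (\<lambda>i. Re (t i (complex_of_real (- \<rho>)))) \<rho> (b\<^sup>2) K"
proof
  let ?z = "complex_of_real (- \<rho>)"
  let ?\<tau> = "\<lambda>i. Re (t i ?z)"
  have st: "t i \<in> stieltjes_transforms" if "i < N" for i
    using sol that by (simp add: solves_system_def)
  have t_real: "t i ?z = complex_of_real (?\<tau> i)" if "i < N" for i
    using stieltjes_transform_neg(1)[OF st[OF that] \<open>0 < \<rho>\<close>] .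
  show "0 \<le> ?\<tau> i" if "i < N" for i
    using stieltjes_transform_neg(2)[OF st[OF that] \<open>0 < \<rho>\<close>] .
  show "(s i j)\<^sup>2 \<le> b\<^sup>2" if "i < N" "j < n" for i j
    using power_mono[OF bound[OF that] abs_ge_zero, of 2] by simp
  show "?\<tau> i = 1 / (\<rho> + 1 / n * (\<Sum>j<n. (s i j)\<^sup>2 / (1 + 1 / n * (\<Sum>l<N. (s l j)\<^sup>2 * ?\<tau> l))))"
    if i: "i < N" for i
  proof -
    have "?z \<notin> \<real>\<^sub>\<ge>\<^sub>0"
      using \<open>0 < \<rho>\<close> by (simp add: complex_nonneg_Reals_iff)
    then have "t i ?z = 1 / (- ?z + 1 / of_nat n * (\<Sum>j<n. complex_of_real ((s i j)\<^sup>2) /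
        (1 + 1 / of_nat n * (\<Sum>l<N. complex_of_real ((s l j)\<^sup>2) * t l ?z))))"
      using sol i unfolding solves_system_def by blast
    also have "\<dots> = complex_of_real
        (1 / (\<rho> + 1 / n * (\<Sum>j<n. (s i j)\<^sup>2 / (1 + 1 / n * (\<Sum>l<N. (s l j)\<^sup>2 * ?\<tau> l)))))"
    proof -
      have "(\<Sum>l<N. complex_of_real ((s l j)\<^sup>2) * t l ?z) =
          (\<Sum>l<N. complex_of_real ((s l j)\<^sup>2) * complex_of_real (?\<tau> l))" for j
        using t_real by (intro sum.cong refl) auto
      then show ?thesis by simp
    qed
    finally show ?thesis
      by (simp only: Re_complex_of_real)
  qed
qed (use assms in auto)

section \<open>Uniform bounds and passage to the limit\<close>

text \<open>Well-definedness of the logarithm is expressed by positivity of the determinant, because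
  \<open>ln\<close> is total in HOL.\<close>

theorem theorem3p1:
  fixes N :: "nat \<Rightarrow> nat"
    and c \<sigma>max \<sigma>min2 \<rho> :: real
    and \<sigma> :: "nat \<Rightarrow> nat \<Rightarrow> nat \<Rightarrow> real"
    and t :: "nat \<Rightarrow> nat \<Rightarrow> complex \<Rightarrow> complex"
  assumes N_pos: "\<And>n. n \<ge> 1 \<Longrightarrow> N n > 0"
    and c_pos: "c > 0"
    and N_lim: "(\<lambda>n. real (N n) / real n) \<longlonglongrightarrow> c"
    and \<sigma>max_pos: "\<sigma>max > 0"
    and \<sigma>_bounded: "\<And>n i j. n \<ge> 1 \<Longrightarrow> i < N n \<Longrightarrow> j < n \<Longrightarrow> \<bar>\<sigma> n i j\<bar> \<le> \<sigma>max"
    and \<sigma>min2_pos: "\<sigma>min2 > 0"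
    and \<sigma>_liminf:
      "liminf (\<lambda>n. ereal (Min ((\<lambda>j. 1 / real n * (\<Sum>i<N n. (\<sigma> n i j)\<^sup>2)) ` {..<n})))
         \<ge> ereal \<sigma>min2"
    and \<rho>_pos: "\<rho> > 0"
    and t_solution: "\<And>n. n \<ge> 1 \<Longrightarrow> solves_system (\<sigma> n) (N n) n (t n)"
  shows "(\<forall>n\<ge>1. Determinant.det (1\<^sub>m n - A_mat (\<sigma> n) (N n) n (t n) \<rho>) > 0) \<and>
    (\<forall>\<kappa>::real. \<kappa> \<ge> -1 \<longrightarrow>
       0 < liminf (\<lambda>n. ereal (V_seq (\<sigma> n) (N n) n (t n) \<rho> + \<kappa> * W_seq (\<sigma> n) (N n) n (t n) \<rho>)) \<and>
       liminf (\<lambda>n. ereal (V_seq (\<sigma> n) (N n) n (t n) \<rho> + \<kappa> * W_seq (\<sigma> n) (N n) n (t n) \<rho>))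
         \<le> limsup (\<lambda>n. ereal (V_seq (\<sigma> n) (N n) n (t n) \<rho> + \<kappa> * W_seq (\<sigma> n) (N n) n (t n) \<rho>)) \<and>
       limsup (\<lambda>n. ereal (V_seq (\<sigma> n) (N n) n (t n) \<rho> + \<kappa> * W_seq (\<sigma> n) (N n) n (t n) \<rho>)) < \<infinity>)"
proof (intro conjI allI impI)
  have profile: "variance_profile (N n) n (\<lambda>i j. (\<sigma> n i j)\<^sup>2)
      (\<lambda>i. Re (t n i (complex_of_real (- \<rho>)))) \<rho> (\<sigma>max\<^sup>2) K"
    if "n \<ge> 1" "real (N n) \<le> K * real n" for n K
    using that N_pos t_solution \<rho>_pos \<sigma>_bounded by (intro variance_profile_of_system) auto
  show "Determinant.det (1\<^sub>m n - A_mat (\<sigma> n) (N n) n (t n) \<rho>) > 0" if n: "n \<ge> 1" for n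
  proof -
    \<comment> \<open>For one fixed \<open>n\<close> the ratio itself serves as \<open>K\<close>;
      uniformity matters only for the bounds in the limit.\<close>
    have "real (N n) \<le> real (N n) / n * real n"
      using n by simp
    note prof = profile[OF n this]
    show ?thesis
      unfolding A_mat_eq[where s = "\<sigma> n" and t = "t n", OF prof]
      by (rule variance_profile.det_pos[OF prof])
  qed
  fix \<kappa> :: real
  assume \<kappa>: "\<kappa> \<ge> -1"
  define X where "X n = V_seq (\<sigma> n) (N n) n (t n) \<rho> + \<kappa> * W_seq (\<sigma> n) (N n) n (t n) \<rho>" for n
  \<comment> \<open>\<open>K\<close> exceeds the limit of the ratios and \<open>\<mu>\<close> lies
    strictly below the liminf of the column means, so both constants are valid for all large
    \<open>n\<close>.\<close>
  define K where "K = c + 1"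
  define U where "U = 1 + K * (\<sigma>max\<^sup>2 / \<rho>)"
  define \<mu> where "\<mu> = \<sigma>min2 / 2"
  have ev_N: "eventually (\<lambda>n. real (N n) / real n < K) sequentially"
    using N_lim by (intro order_tendstoD) (auto simp: K_def)
  have "ereal \<mu> < liminf (\<lambda>n. ereal (Min ((\<lambda>j. 1 / real n * (\<Sum>i<N n. (\<sigma> n i j)\<^sup>2)) ` {..<n})))"
    using \<sigma>min2_pos by (intro order_less_le_trans[OF _ \<sigma>_liminf]) (simp add: \<mu>_def)
  then have ev_min: "eventually (\<lambda>n. \<mu> < Min ((\<lambda>j. 1 / real n * (\<Sum>i<N n. (\<sigma> n i j)\<^sup>2)) ` {..<n})) sequentially"
    by (auto dest!: less_LiminfD)
  define lo where "lo = \<mu> ^ 4 / ((\<rho> + \<sigma>max\<^sup>2) ^ 4 * K\<^sup>2 * U ^ 4) / 2"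
  define hi where "hi = (U + \<bar>\<kappa>\<bar>) * (K * (\<sigma>max\<^sup>2 / \<rho>)\<^sup>2)"
  have ev: "eventually (\<lambda>n. lo \<le> X n \<and> X n \<le> hi) sequentially"
    using ev_N ev_min eventually_ge_at_top[of 1]
  proof eventually_elim
    case (elim n)
    then have n: "n \<ge> 1" by simp
    have "real (N n) \<le> K * real n"
      using elim(1) n by (simp add: divide_less_eq)
    note prof = profile[OF n this]
    interpret P: variance_profile "N n" n "\<lambda>i j. (\<sigma> n i j)\<^sup>2"
      "\<lambda>i. Re (t n i (complex_of_real (- \<rho>)))" \<rho> "\<sigma>max\<^sup>2" K
      by (rule prof)
    have "\<mu> * n \<le> (\<Sum>i<N n. (\<sigma> n i j)\<^sup>2)" if "j < n" for j
    proof -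
      \<comment> \<open>The index \<open>j < n\<close> makes the set nonempty, so \<open>Min\<close>
        is a genuine minimum. Summing over the columns below gives the total mass
        \<open>\<mu> * n\<^sup>2\<close>.\<close>
      have "\<mu> < 1 / real n * (\<Sum>i<N n. (\<sigma> n i j)\<^sup>2)"
        using elim(2) that by (subst (asm) Min_gr_iff) auto
      then show ?thesis
        using n by (simp add: field_simps)
    qed
    then have "(\<Sum>j<n. \<mu> * n) \<le> (\<Sum>j<n. \<Sum>i<N n. (\<sigma> n i j)\<^sup>2)"
      by (intro sum_mono) auto
    then have mean: "\<mu> * (real n)\<^sup>2 \<le> (\<Sum>j<n. \<Sum>i<N n. (\<sigma> n i j)\<^sup>2)"
      by (simp add: power2_eq_square mult_ac)
    have "X n = - ln (det (1\<^sub>m n - P.A)) + \<kappa> * mat_trace P.A"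
      unfolding X_def V_seq_def W_seq_def A_mat_eq[where s = "\<sigma> n" and t = "t n", OF prof] ..
    then show ?case
      using P.log_det_lower[OF _ mean \<kappa>] P.log_det_upper[of \<kappa>] \<sigma>min2_pos
      unfolding lo_def hi_def U_def P.U_def by (simp add: \<mu>_def)
  qed
  have "0 < \<rho> + \<sigma>max\<^sup>2" "0 < K" "0 < U"
    using \<rho>_pos c_pos by (auto simp: K_def U_def intro!: add_pos_nonneg)
  then have "0 < lo"
    using \<sigma>min2_pos by (simp add: lo_def \<mu>_def)
  then have "0 < ereal lo"
    by simp
  also have "ereal lo \<le> liminf (\<lambda>n. ereal (X n))"
    using ev by (intro Liminf_bounded) (auto elim: eventually_mono)
  finally show "0 < liminf (\<lambda>n. ereal (V_seq (\<sigma> n) (N n) n (t n) \<rho> + \<kappa> * W_seq (\<sigma> n) (N n) n (t n) \<rho>))"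
    unfolding X_def .
  show "liminf (\<lambda>n. ereal (V_seq (\<sigma> n) (N n) n (t n) \<rho> + \<kappa> * W_seq (\<sigma> n) (N n) n (t n) \<rho>))
      \<le> limsup (\<lambda>n. ereal (V_seq (\<sigma> n) (N n) n (t n) \<rho> + \<kappa> * W_seq (\<sigma> n) (N n) n (t n) \<rho>))"
    by (intro Liminf_le_Limsup) simp
  have "limsup (\<lambda>n. ereal (X n)) \<le> ereal hi"
    using ev by (intro Limsup_bounded) (auto elim: eventually_mono)
  also have "\<dots> < \<infinity>"
    by simp
  finally show "limsup (\<lambda>n. ereal (V_seq (\<sigma> n) (N n) n (t n) \<rho> + \<kappa> * W_seq (\<sigma> n) (N n) n (t n) \<rho>)) < \<infinity>"
    unfolding X_def .
qed

end
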